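(* Let $k$ be a field. For each $c\in k$, let $p^{(c)}\in k^k$ be the function which for every $x\in k-\{c\}$ has $p^{(c)}(x)=(x-c)^{-1}$, and which at $c$ has the value $0$. Then any nontrivial linear combination of the elements $p^{(c)}$ $(c\in k)$ has at most finitely many zeroes (i.e., a finite linear combination, with coefficients in $k$ not all zero, of functions $p^{(c)}$ for distinct $c\in k$ vanishes at only finitely many points of $k$). Hence if $I$ is a set of cardinality $\leq\mathrm{card}(k)$, and $g$ is a $k$-linear map from $k^I$ to a $k$-vector space $V$ of dimension $<\mathrm{card}(k)$, then $\ker(g)$ contains an element $u$ of cofinite support.
   Context: For $u=(u_i)_{i\in I}\in k^I$, $\mathrm{supp}(u)=\{i\in I\mid u_i\neq 0\}$; $u$ has cofinite support if $I-\mathrm{supp}(u)$ is finite. *)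

theory Defs
  imports Complex_Main "HOL-Library.FuncSet" "HOL-Library.Equipollence"
begin

definition p_fun :: "'k::field \<Rightarrow> 'k \<Rightarrow> 'k" where
  "p_fun c x = (if x = c then 0 else inverse (x - c))"

text \<open>For a subset \<open>I\<close> of a type, the space \<open>k\<^sup>I\<close> is the set \<open>I \<rightarrow>\<^sub>E UNIV\<close> of extensional
  functions. Its elements take the value \<open>undefined\<close> outside \<open>I\<close>, so sums and scalar multiples
  have to be restricted to \<open>I\<close>, and supports are taken inside \<open>I\<close>.\<close>

definition linear_on_power ::
    "'i set \<Rightarrow> ('k::field \<Rightarrow> 'v::ab_group_add \<Rightarrow> 'v) \<Rightarrow> (('i \<Rightarrow> 'k) \<Rightarrow> 'v) \<Rightarrow> bool" where
  "linear_on_power I scale g \<longleftrightarrow>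
     (\<forall>u \<in> I \<rightarrow>\<^sub>E UNIV. \<forall>v \<in> I \<rightarrow>\<^sub>E UNIV. g (\<lambda>i\<in>I. u i + v i) = g u + g v) \<and>
     (\<forall>c. \<forall>u \<in> I \<rightarrow>\<^sub>E UNIV. g (\<lambda>i\<in>I. c * u i) = scale c (g u))"

definition supp :: "'i set \<Rightarrow> ('i \<Rightarrow> 'k::zero) \<Rightarrow> 'i set" where
  "supp I u = {i \<in> I. u i \<noteq> 0}"

definition cofinite_support :: "'i set \<Rightarrow> ('i \<Rightarrow> 'k::zero) \<Rightarrow> bool" where
  "cofinite_support I u \<longleftrightarrow> finite (I - supp I u)"

text \<open>The library's \<open>dim\<close> is a natural number and is \<open>0\<close> for infinite-dimensional spaces, so
  the comparison of the (possibly infinite) dimension with the cardinality of a set \<open>S\<close> is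
  expressed through a basis.\<close>

definition (in vector_space) dim_less_card :: "'s set \<Rightarrow> bool" where
  "dim_less_card S \<longleftrightarrow> (\<exists>B. independent B \<and> span B = UNIV \<and> B \<prec> S)"

end

theory Submission
  imports Defs "HOL-Computational_Algebra.Polynomial"
begin

text \<open>Multiplying \<open>\<Sum>c\<in>C. a c / (x - c)\<close> by \<open>\<Prod>c\<in>C. x - c\<close> gives a polynomial whose value at
  each \<open>c \<in> C\<close> with \<open>a c \<noteq> 0\<close> is nonzero, so it has finitely many roots. For the second part,
  transport the functions \<open>p_fun c\<close> to \<open>I\<close> along an injection into the field. Their images under
  \<open>g\<close> are a family indexed by the field in a space of smaller dimension, so they satisfy a
  nontrivial linear relation; the corresponding combination lies in the kernel.\<close>

lemma finite_zeros_sum_p_fun: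
  fixes a :: "'k::field \<Rightarrow> 'k"
  assumes "finite C" "\<exists>c\<in>C. a c \<noteq> 0"
  shows "finite {x. (\<Sum>c\<in>C. a c * p_fun c x) = 0}"
proof -
  define q where "q = (\<Sum>c\<in>C. smult (a c) (\<Prod>d\<in>C-{c}. [:-d, 1:]))"
  have poly_q: "poly q x = (\<Sum>c\<in>C. a c * (\<Prod>d\<in>C-{c}. x - d))" for x
    by (simp add: q_def poly_sum poly_prod)
  obtain e where e: "e \<in> C" "a e \<noteq> 0" using assms by blast
  \<comment> \<open>Each of these terms contains the factor \<open>e - e\<close>, from
    \<open>d = e\<close>; evaluating at \<open>e\<close> therefore isolates the coefficient
    \<open>a e\<close>.\<close>
  have "(\<Sum>c\<in>C-{e}. a c * (\<Prod>d\<in>C-{c}. e - d)) = 0"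
    using assms(1) e by (intro sum.neutral) auto
  then have "poly q e = a e * (\<Prod>d\<in>C-{e}. e - d)"
    unfolding poly_q using assms(1) e by (simp add: sum.remove[of C e])
  then have "poly q e \<noteq> 0" using assms(1) e by auto
  then have fin: "finite {x. poly q x = 0}" by (intro poly_roots_finite) auto
  \<comment> \<open>Off \<open>C\<close> no \<open>p_fun c\<close> takes its default value 0, so
    denominators can be cleared. The finitely many points of \<open>C\<close> are simply added to
    the root set below.\<close>
  have "poly q x = (\<Prod>d\<in>C. x - d) * (\<Sum>c\<in>C. a c * p_fun c x)" if "x \<notin> C" for x
  proof -
    have "a c * (\<Prod>d\<in>C-{c}. x - d) = (\<Prod>d\<in>C. x - d) * (a c * p_fun c x)" if "c \<in> C" for c
      using that \<open>x \<notin> C\<close> assms(1) by (auto simp: p_fun_def prod.remove[of C c])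
    then show ?thesis unfolding poly_q sum_distrib_left by (intro sum.cong refl)
  qed
  then have "{x. (\<Sum>c\<in>C. a c * p_fun c x) = 0} \<subseteq> C \<union> {x. poly q x = 0}" by auto
  then show ?thesis using fin assms(1) by (meson finite_UnI finite_subset)
qed

text \<open>For finite \<open>B\<close> this is the exchange bound. For infinite \<open>B\<close>,
  extend \<open>S\<close> to a basis \<open>E\<close> and express each \<open>b\<close> in
  \<open>B\<close> by finitely many elements of \<open>E\<close>. The union \<open>T\<close> of
  these finite sets spans the space, so independence forces \<open>T = E\<close>, and a union of
  finite sets indexed by an infinite \<open>B\<close> is no larger than \<open>B\<close>.\<close>

lemma (in vector_space) independent_lepoll_spanning:
  assumes S: "independent S" and B: "span B = UNIV"
  shows "S \<lesssim> B"
proof (cases "finite B")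
  case True
  then have "finite S \<and> card S \<le> card B" using independent_span_bound[OF True S] B by simp
  then show ?thesis using True by (simp add: lepoll_iff_card_le)
next
  case False
  define E where "E = extend_basis S"
  have E: "S \<subseteq> E" "independent E" "span E = UNIV"
    using extend_basis_superset[OF S] independent_extend_basis[OF S] span_extend_basis[OF S]
    by (auto simp: E_def)
  have "\<exists>F. finite F \<and> F \<subseteq> E \<and> b \<in> span F" for b
  proof -
    have "b \<in> span E" using E by simp
    then obtain t r where "finite t" "t \<subseteq> E" "b = (\<Sum>v\<in>t. r v *s v)"
      unfolding span_explicit by blast
    then show ?thesis by (intro exI[of _ t]) (auto intro: span_sum span_scale span_base)
  qed
  then obtain F where F: "\<And>b. finite (F b)" "\<And>b. F b \<subseteq> E" "\<And>b. b \<in> span (F b)" by metis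
  define T where "T = (\<Union>b\<in>B. F b)"
  have "B \<subseteq> span T" using F(3) span_mono[of _ T] unfolding T_def by blast
  then have "span T = UNIV" using B span_minimal subspace_span by blast
  moreover have "T \<subseteq> E" using F(2) by (auto simp: T_def)
  ultimately have "T = E"
  proof (intro equalityI subsetI)
    fix e assume "e \<in> E"
    show "e \<in> T"
    proof (rule ccontr)
      assume "e \<notin> T"
      then have "span T \<subseteq> span (E - {e})" using \<open>T \<subseteq> E\<close> by (intro span_mono) auto
      then show False using \<open>span T = UNIV\<close> \<open>e \<in> E\<close> E(2) by (auto simp: dependent_def)
    qed
  qed auto
  moreover have "(card_of T, card_of B) \<in> ordLeq"
    unfolding T_def using False F(1)
    by (intro card_of_UNION_ordLeq_infinite) (auto simp: ordLeq3_finite_infinite card_of_mono1)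
  ultimately have "E \<lesssim> B" using lepoll_def card_of_ordLeq by metis
  then show ?thesis using E(1) by (meson lepoll_trans subset_imp_lepoll)
qed

text \<open>The relation is indexed by \<open>A\<close> because \<open>h\<close> may repeat values.
  Dependence of the set of values settles the injective case; a repetition \<open>h c = h d\<close>
  gives the relation \<open>h c - h d = 0\<close> directly.\<close>

lemma (in vector_space) family_dependent_of_dim_less_card:
  assumes "dim_less_card A"
  obtains C a where "finite C" "C \<subseteq> A" "\<exists>c\<in>C. a c \<noteq> 0" "(\<Sum>c\<in>C. a c *s h c) = 0"
proof (cases "inj_on h A")
  case True
  obtain B where B: "span B = UNIV" "B \<prec> A" using assms by (auto simp: dim_less_card_def)
  \<comment> \<open>By Schroeder-Bernstein, injections both ways would make \<open>A\<close> and
    \<open>B\<close> equipollent.\<close>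
  have "\<not> A \<lesssim> B" using B(2) by (meson lesspoll_def lepoll_antisym)
  moreover have "A \<lesssim> h ` A" using True
    by (simp add: eqpoll_imp_lepoll eqpoll_sym inj_on_image_eqpoll_self)
  ultimately have "dependent (h ` A)"
    using independent_lepoll_spanning[OF _ B(1)] lepoll_trans by blast
  then obtain t r where t: "finite t" "t \<subseteq> h ` A" "(\<Sum>v\<in>t. r v *s v) = 0" "\<exists>v\<in>t. r v \<noteq> 0"
    unfolding dependent_explicit by blast
  then obtain C where C: "C \<subseteq> A" "finite C" "t = h ` C" by (meson finite_subset_image)
  have "inj_on h C" using True C(1) inj_on_subset by blast
  then have "(\<Sum>c\<in>C. r (h c) *s h c) = 0" using t(3) C(3) by (simp add: sum.reindex)
  then show ?thesis using that[of C "r \<circ> h"] C t(4) by auto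
next
  case False
  then obtain c d where cd: "c \<in> A" "d \<in> A" "c \<noteq> d" "h c = h d" by (auto simp: inj_on_def)
  show ?thesis
    by (rule that[of "{c, d}" "\<lambda>x. if x = c then 1 else - 1"]) (use cd in auto)
qed

text \<open>Induction on \<open>C\<close> passes from two summands to finitely many; restricting
  every summand to \<open>I\<close> keeps it extensional, as \<open>linear_on_power\<close>
  demands.\<close>

lemma linear_on_power_sum:
  fixes g :: "('i \<Rightarrow> 'k::field) \<Rightarrow> 'v::ab_group_add"
  assumes "vector_space scale" and g: "linear_on_power I scale g" and "finite C"
  shows "g (\<lambda>i\<in>I. \<Sum>c\<in>C. a c * q c i) = (\<Sum>c\<in>C. scale (a c) (g (\<lambda>i\<in>I. q c i)))"
proof -
  have add: "g (\<lambda>i\<in>I. u i + v i) = g u + g v" if "u \<in> I \<rightarrow>\<^sub>E UNIV" "v \<in> I \<rightarrow>\<^sub>E UNIV" for u v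
    using g that unfolding linear_on_power_def by simp
  have mult: "g (\<lambda>i\<in>I. b * u i) = scale b (g u)" if "u \<in> I \<rightarrow>\<^sub>E UNIV" for b u
    using g that unfolding linear_on_power_def by simp
  show ?thesis
    using \<open>finite C\<close>
  proof (induction C rule: finite_induct)
    case empty
    \<comment> \<open>The zero function is 0 times itself, so homogeneity makes its image
      zero.\<close>
    show ?case
      using mult[of "\<lambda>i\<in>I. 0" 0] module.scale_zero_left[of scale] assms(1)
      by (simp add: module_iff_vector_space restrict_def PiE_iff extensional_def)
  next
    case (insert e C)
    show ?case
      using insert add[of "\<lambda>i\<in>I. a e * q e i" "\<lambda>i\<in>I. \<Sum>c\<in>C. a c * q c i"]
        mult[of "\<lambda>i\<in>I. q e i" "a e"]
      by (simp add: restrict_def PiE_iff extensional_def cong: if_cong)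
  qed
qed

lemma kernel_has_cofinite_support:
  fixes scale :: "'k::field \<Rightarrow> 'v::ab_group_add \<Rightarrow> 'v" and g :: "('i \<Rightarrow> 'k) \<Rightarrow> 'v"
  assumes "I \<lesssim> (UNIV :: 'k set)" "vector_space scale"
    "vector_space.dim_less_card scale (UNIV :: 'k set)" "linear_on_power I scale g"
  shows "\<exists>u \<in> I \<rightarrow>\<^sub>E UNIV. g u = 0 \<and> cofinite_support I u"
proof -
  obtain f :: "'i \<Rightarrow> 'k" where f: "inj_on f I" using assms(1) by (auto simp: lepoll_def)
  obtain C a where C: "finite C" "\<exists>c\<in>C. a c \<noteq> 0"
    and rel: "(\<Sum>c\<in>C. scale (a c) (g (\<lambda>i\<in>I. p_fun c (f i)))) = 0"
    by (rule vector_space.family_dependent_of_dim_less_card[OF assms(2,3),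
          where h = "\<lambda>c. g (\<lambda>i\<in>I. p_fun c (f i))"])
  define u where "u = (\<lambda>i\<in>I. \<Sum>c\<in>C. a c * p_fun c (f i))"
  \<comment> \<open>Zeros of \<open>u\<close> are pulled back along \<open>f\<close>; injectivity on
    \<open>I\<close> keeps the preimage of a finite set finite.\<close>
  have "I - supp I u = f -` {x. (\<Sum>c\<in>C. a c * p_fun c x) = 0} \<inter> I"
    by (auto simp: supp_def u_def)
  then have "cofinite_support I u"
    unfolding cofinite_support_def using finite_zeros_sum_p_fun[OF C] f
    by (metis finite_vimage_IntI)
  moreover have "g u = 0"
    unfolding u_def linear_on_power_sum[OF assms(2,4) C(1)] by (rule rel)
  moreover have "u \<in> I \<rightarrow>\<^sub>E UNIV" by (simp add: u_def)
  ultimately show ?thesis by blast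
qed

theorem lemma5:
  "(\<forall>(C :: 'k::field set) (a :: 'k \<Rightarrow> 'k).
      finite C \<longrightarrow> (\<exists>c\<in>C. a c \<noteq> 0) \<longrightarrow> finite {x. (\<Sum>c\<in>C. a c * p_fun c x) = 0}) \<and>
   (\<forall>(I :: 'i set) (scale :: 'k \<Rightarrow> 'v::ab_group_add \<Rightarrow> 'v) (g :: ('i \<Rightarrow> 'k) \<Rightarrow> 'v).
      I \<lesssim> (UNIV :: 'k set) \<longrightarrow>
      vector_space scale \<longrightarrow>
      vector_space.dim_less_card scale (UNIV :: 'k set) \<longrightarrow>
      linear_on_power I scale g \<longrightarrow>
      (\<exists>u \<in> I \<rightarrow>\<^sub>E UNIV. g u = 0 \<and> cofinite_support I u))"
  using finite_zeros_sum_p_fun kernel_has_cofinite_support by blast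

end
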